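(* Let $q$ be a prime power and let $k<n$ be positive integers with $k\mid n$. Then $$P(n,k,q)\ >\ \frac{q^{k}-1}{q^{n}-1}{n-1 \brack k-1}_{q}.$$
   Context: $V(n,q)$ denotes an $n$-dimensional vector space over the finite field $\mathbb{F}_q$. A $k$-spread of $V(n,q)$ is a set of $k$-dimensional $\mathbb{F}_q$-subspaces of $V(n,q)$ such that every nonzero vector lies in exactly one of them. A partial $k$-parallelism of $V(n,q)$ is a collection of $k$-spreads of $V(n,q)$ that are pairwise disjoint as sets of subspaces (no $k$-dimensional subspace belongs to two of the spreads). $P(n,k,q)$ denotes the maximum size (number of spreads) of a partial $k$-parallelism of $V(n,q)$. The $q$-ary Gaussian coefficient is $${a \brack b}_q=\frac{(q^{a}-1)(q^{a-1}-1)\cdots(q^{a-b+1}-1)}{(q^{b}-1)(q^{b-1}-1)\cdots(q-1)},$$ the number of $b$-dimensional subspaces of $V(a,q)$ (equal to $1$ when $b=0$). *)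

theory Defs
  imports Complex_Main "HOL-Library.Cardinality"
begin

text \<open>
  The scalar multiplication is an explicit argument; the definitions are meant for an instance
  of the locale \<open>vector_space\<close>. Since \<open>dim\<close> of an infinite-dimensional space is \<open>0\<close>, a
  hypothesis \<open>dim UNIV = n\<close> with \<open>n > 0\<close> entails finite dimension.
\<close>

definition spread ::
  "('a::field \<Rightarrow> 'b::ab_group_add \<Rightarrow> 'b) \<Rightarrow> nat \<Rightarrow> 'b set set \<Rightarrow> bool" where
  "spread scale k S \<longleftrightarrow>
     (\<forall>W\<in>S. module.subspace scale W \<and> vector_space.dim scale W = k) \<and>
     (\<forall>v. v \<noteq> 0 \<longrightarrow> (\<exists>!W. W \<in> S \<and> v \<in> W))"

definition partial_parallelism ::
  "('a::field \<Rightarrow> 'b::ab_group_add \<Rightarrow> 'b) \<Rightarrow> nat \<Rightarrow> 'b set set set \<Rightarrow> bool" where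
  "partial_parallelism scale k P \<longleftrightarrow> (\<forall>S\<in>P. spread scale k S) \<and> pairwise disjnt P"

text \<open>
  The number \<open>P(n,k,q)\<close>, where \<open>n\<close> is the dimension of the ambient space and \<open>q\<close> the number of
  scalars. When the space is finite, it has only finitely many partial parallelisms, and the empty
  collection is one of them, so \<open>Max\<close> is then a genuine maximum.
\<close>

definition max_partial_parallelism ::
  "('a::field \<Rightarrow> 'b::ab_group_add \<Rightarrow> 'b) \<Rightarrow> nat \<Rightarrow> nat" where
  "max_partial_parallelism scale k = Max (card ` {P. partial_parallelism scale k P})"

text \<open>
  For \<open>b > a\<close> the numerator contains the factor \<open>q ^ 0 - 1\<close>, so the truncated
  subtraction gives the correct value \<open>0\<close>.
\<close>

definition gaussian_coeff :: "nat \<Rightarrow> nat \<Rightarrow> nat \<Rightarrow> real" where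
  "gaussian_coeff q a b =
     (\<Prod>i<b. (real q ^ (a - i) - 1)) / (\<Prod>i<b. (real q ^ (b - i) - 1))"

end

theory Submission
  imports Defs "HOL-Algebra.Algebraic_Closure_Type"
begin

text \<open>
  Identify the space with the field with \<open>q ^ n\<close> elements; the multiplicative cosets of its subfield
  with \<open>q ^ k\<close> elements, together with 0, form a spread \<open>S\<close>. Let \<open>P\<close> be an inclusion-maximal
  partial parallelism containing \<open>S\<close>, with union \<open>U\<close>. By maximality, each image \<open>g S\<close> under the
  general linear group meets \<open>U\<close>, and \<open>S\<close> itself meets it in \<open>card S > 1\<close> subspaces. As the group is
  transitive on the \<open>N\<close> subspaces of dimension \<open>k\<close>, the average size of \<open>g S \<inter> U\<close> is
  \<open>card S * card U / N\<close>, hence \<open>card S ^ 2 * card P = card S * card U > N\<close>. Finally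
  \<open>card S = (q ^ n - 1) / (q ^ k - 1)\<close> and \<open>N\<close> is \<open>card S\<close> times the Gaussian coefficient.
\<close>

section \<open>Subspaces of a finite vector space\<close>

context vector_space
begin

text \<open>Induction on the basis: an element of \<open>span (insert b B)\<close> is uniquely
  \<open>c *s b + v\<close> with \<open>v\<close> in \<open>span B\<close>, so each new basis vector
  multiplies the size by \<open>CARD('a)\<close>.\<close>

lemma finite_card_span:
  assumes "finite (UNIV :: 'a set)" "finite B" "independent B"
  shows "finite (span B) \<and> card (span B) = CARD('a) ^ card B"
  using assms(2,3)
proof (induction B rule: finite_induct)
  case empty
  then show ?case by simp
next
  case (insert b B)
  have B: "independent B" and b: "b \<notin> span B"
    using insert independent_insert[of b B] by auto
  have "bij_betw (\<lambda>(c, v). c *s b + v) (UNIV \<times> span B) (span (insert b B))"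
    unfolding bij_betw_def
  proof
    show "inj_on (\<lambda>(c, v). c *s b + v) (UNIV \<times> span B)"
    proof (rule inj_onI, clarify)
      fix c v d w assume *: "v \<in> span B" "w \<in> span B" "c *s b + v = d *s b + w"
      then have "(c - d) *s b = w - v"
        by (simp add: scale_left_diff_distrib algebra_simps)
      then have "(c - d) *s b \<in> span B"
        using * by (simp add: span_diff)
      then have "c = d"
        using b span_scale[of "(c - d) *s b" B "inverse (c - d)"] by (cases "c = d") auto
      then show "c = d \<and> v = w" using * by simp
    qed
    show "(\<lambda>(c, v). c *s b + v) ` (UNIV \<times> span B) = span (insert b B)"
    proof (intro equalityI subsetI)
      fix x assume "x \<in> span (insert b B)"
      then obtain c where "x - c *s b \<in> span B" by (auto simp: span_insert)
      then show "x \<in> (\<lambda>(c, v). c *s b + v) ` (UNIV \<times> span B)"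
        by (intro image_eqI[of _ _ "(c, x - c *s b)"]) auto
    next
      fix x assume "x \<in> (\<lambda>(c, v). c *s b + v) ` (UNIV \<times> span B)"
      then obtain c v where "x = c *s b + v" "v \<in> span B" by auto
      then show "x \<in> span (insert b B)" by (auto simp: span_breakdown_eq intro!: exI[of _ c])
    qed
  qed
  then have "card (span (insert b B)) = card ((UNIV :: 'a set) \<times> span B)"
    and "finite (span (insert b B)) \<longleftrightarrow> finite ((UNIV :: 'a set) \<times> span B)"
    using bij_betw_same_card bij_betw_finite by metis+
  then show ?case
    using insert B assms(1) by (simp add: card_cartesian_product)
qed

lemma card_subspace:
  assumes "finite (UNIV :: 'a set)" "finite W" "subspace W"
  shows "card W = CARD('a) ^ dim W"
proof -
  obtain B where B: "B \<subseteq> W" "independent B" "W \<subseteq> span B" "card B = dim W"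
    using basis_exists by metis
  then have "span B = W" using assms by (simp add: span_subspace)
  then show ?thesis
    using finite_card_span[of B] assms B finite_subset by metis
qed

end

lemma two_le_card_field:
  assumes "finite (UNIV :: 'a::field set)"
  shows "2 \<le> CARD('a)"
  using card_mono[OF assms, of "{0, 1}"] by simp

locale finite_vector_space = finite_dimensional_vector_space scale Basis
  for scale :: "'a::field \<Rightarrow> 'b::ab_group_add \<Rightarrow> 'b" (infixr \<open>*s\<close> 75) and Basis +
  assumes finite_scalars: "finite (UNIV :: 'a set)"
begin

lemma finite_vectors: "finite (UNIV :: 'b set)"
  using finite_card_span[OF finite_scalars finite_Basis independent_Basis] span_Basis by simp

lemma finite_vector_set [simp]: "finite (A :: 'b set)"
  by (rule finite_subset[OF subset_UNIV finite_vectors])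

lemma finite_vector_set_set [simp]: "finite (\<A> :: 'b set set)"
  by (rule finite_subset[OF _ finite_Pow_iff[THEN iffD2, OF finite_vectors]]) simp

lemma card_subspace': "subspace W \<Longrightarrow> card W = CARD('a) ^ dim W"
  by (simp add: card_subspace finite_scalars)

text \<open>Powers of a number that is at least 2 determine their exponents. Preservation of
  dimension can thus be checked by counting elements.\<close>

lemma dim_eq_iff_card_eq:
  assumes "subspace V" "subspace W"
  shows "dim V = dim W \<longleftrightarrow> card V = card W"
  using two_le_card_field[OF finite_scalars] by (simp add: card_subspace' assms)

section \<open>Counting subspaces by their ordered bases\<close>

definition grassmannian :: "nat \<Rightarrow> 'b set set" where
  "grassmannian k = {W. subspace W \<and> dim W = k}"

text \<open>Ordering makes the count a product: the number of ways to extend a list inside a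
  subspace depends only on its length.\<close>

definition independent_lists :: "'b set \<Rightarrow> nat \<Rightarrow> 'b list set" where
  "independent_lists W k = {xs. length xs = k \<and> distinct xs \<and> independent (set xs) \<and> set xs \<subseteq> W}"

lemma finite_independent_lists [simp]: "finite (independent_lists W k)"
  by (rule finite_subset[OF _ finite_lists_length_eq[of W k]]) (auto simp: independent_lists_def)

text \<open>A list extends by exactly the vectors of \<open>W\<close> outside its span, and the span
  has \<open>CARD('a) ^ k\<close> elements. For \<open>k > dim W\<close> the factor at
  \<open>i = dim W\<close> makes the product 0, as it should be.\<close>

lemma card_independent_lists:
  assumes "subspace W"
  shows "card (independent_lists W k) = (\<Prod>i<k. card W - CARD('a) ^ i)"
proof (induction k)
  case 0
  have "independent_lists W 0 = {[]}" using independent_empty by (auto simp: independent_lists_def)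
  then show ?case by simp
next
  case (Suc k)
  let ?S = "SIGMA xs : independent_lists W k. W - span (set xs)"
  have "bij_betw (\<lambda>(xs, v). v # xs) ?S (independent_lists W (Suc k))"
    unfolding bij_betw_def
  proof
    show "inj_on (\<lambda>(xs, v). v # xs) ?S" by (auto simp: inj_on_def)
    show "(\<lambda>(xs, v). v # xs) ` ?S = independent_lists W (Suc k)"
    proof (intro equalityI subsetI)
      fix ys assume "ys \<in> independent_lists W (Suc k)"
      then obtain v xs where "ys = v # xs" "xs \<in> independent_lists W k" "v \<in> W - span (set xs)"
        by (cases ys) (auto simp: independent_lists_def independent_insert split: if_splits)
      then show "ys \<in> (\<lambda>(xs, v). v # xs) ` ?S" by (force simp: image_iff)
    qed (auto simp: independent_lists_def span_base dest: independent_insertI)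
  qed
  then have "card (independent_lists W (Suc k)) = card ?S"
    using bij_betw_same_card by force
  also have "\<dots> = (\<Sum>xs\<in>independent_lists W k. card (W - span (set xs)))"
    by (rule card_SigmaI) auto
  also have "\<dots> = (\<Sum>xs\<in>independent_lists W k. card W - CARD('a) ^ k)"
  proof (rule sum.cong[OF refl])
    fix xs assume "xs \<in> independent_lists W k"
    then have xs: "set xs \<subseteq> W" "independent (set xs)" "card (set xs) = k"
      by (auto simp: independent_lists_def distinct_card)
    then have "span (set xs) \<subseteq> W" by (simp add: assms span_minimal)
    then show "card (W - span (set xs)) = card W - CARD('a) ^ k"
      using finite_card_span[OF finite_scalars _ xs(2)] xs(3) by (simp add: card_Diff_subset)
  qed
  finally show ?case by (simp add: Suc.IH)
qed

text \<open>Double counting: an independent list of length \<open>k\<close> is an ordered basis of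
  exactly one \<open>k\<close>-dimensional subspace, its span.\<close>

lemma card_grassmannian:
  "card (grassmannian k) * (\<Prod>i<k. CARD('a) ^ k - CARD('a) ^ i) =
     (\<Prod>i<k. CARD('a) ^ dimension - CARD('a) ^ i)"
proof -
  have span_eq: "span (set xs) = W" if "W \<in> grassmannian k" "xs \<in> independent_lists W k" for W xs
    using that subspace_dim_equal[of "span (set xs)" W]
    by (simp add: grassmannian_def independent_lists_def span_minimal dim_eq_card_independent
        distinct_card)
  have "independent_lists UNIV k = (\<Union>W\<in>grassmannian k. independent_lists W k)"
  proof (intro equalityI subsetI)
    fix xs assume "xs \<in> independent_lists UNIV k"
    then have "span (set xs) \<in> grassmannian k" "xs \<in> independent_lists (span (set xs)) k"
      by (simp_all add: independent_lists_def grassmannian_def dim_eq_card_independent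
          distinct_card span_superset)
    then show "xs \<in> (\<Union>W\<in>grassmannian k. independent_lists W k)" by blast
  qed (auto simp: independent_lists_def)
  then have "card (independent_lists UNIV k) = card (\<Union>W\<in>grassmannian k. independent_lists W k)"
    by (rule arg_cong)
  also have "\<dots> = (\<Sum>W\<in>grassmannian k. card (independent_lists W k))"
    using span_eq by (intro card_UN_disjoint ballI impI) (simp, simp, blast)
  also have "\<dots> = (\<Sum>W\<in>grassmannian k. \<Prod>i<k. CARD('a) ^ k - CARD('a) ^ i)"
    by (intro sum.cong refl) (auto simp: grassmannian_def card_independent_lists card_subspace')
  finally show ?thesis
    by (simp add: card_independent_lists card_subspace' dimension_def)
qed

section \<open>Averaging over the general linear group\<close>

definition general_linear :: "('b \<Rightarrow> 'b) set" where
  "general_linear = {f. Vector_Spaces.linear scale scale f \<and> bij f}"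

lemma finite_general_linear [simp]: "finite general_linear"
  using finite_subset[OF _ finite_set_of_finite_funs[OF finite_vectors finite_vectors]]
  by (auto simp: general_linear_def)

lemma general_linear_comp: "f \<in> general_linear \<Longrightarrow> g \<in> general_linear \<Longrightarrow> f \<circ> g \<in> general_linear"
  by (auto simp: general_linear_def bij_comp intro: Vector_Spaces.linear_compose)

lemma image_in_grassmannian:
  assumes f: "f \<in> general_linear" and W: "W \<in> grassmannian k"
  shows "f ` W \<in> grassmannian k"
proof -
  interpret f: Vector_Spaces.linear scale scale f
    using f by (simp add: general_linear_def)
  have "subspace W" "subspace (f ` W)"
    using W f.subspace_image by (auto simp: grassmannian_def)
  moreover have "card (f ` W) = card W"
    using f by (auto simp: general_linear_def bij_def intro: card_image inj_on_subset)
  ultimately show ?thesis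
    using W dim_eq_iff_card_eq by (auto simp: grassmannian_def)
qed

text \<open>A bijection between bases of \<open>V\<close> and \<open>W\<close> extends to an
  injective linear map on the whole space, which is onto because the space is finite.\<close>

lemma general_linear_transitive:
  assumes "V \<in> grassmannian k" "W \<in> grassmannian k"
  obtains f where "f \<in> general_linear" "f ` V = W"
proof -
  obtain B where B: "B \<subseteq> V" "independent B" "V \<subseteq> span B" "card B = k"
    using assms basis_exists[of V] by (auto simp: grassmannian_def)
  obtain C where C: "C \<subseteq> W" "independent C" "W \<subseteq> span C" "card C = k"
    using assms basis_exists[of W] by (auto simp: grassmannian_def)
  have span: "span B = V" "span C = W"
    using assms B C by (auto simp: grassmannian_def span_subspace)
  obtain h where h: "bij_betw h B C"
    using B C by (metis bij_betw_iff_card finite_vector_set)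
  then obtain f where f: "Vector_Spaces.linear scale scale f" "inj f" "\<forall>x\<in>B. f x = h x"
    using linear_independent_extend_inj[of B h] B C by (auto simp: bij_betw_def)
  have "f ` B = C" using f h by (auto simp: bij_betw_def)
  then have "f ` V = W"
    using module_hom.span_image[of scale scale f B] f span by (simp add: module_hom_iff_linear)
  moreover have "f \<in> general_linear"
    using f finite_UNIV_inj_surj[OF finite_vectors] by (simp add: general_linear_def bij_def)
  ultimately show ?thesis using that by blast
qed

text \<open>Transport by composition: \<open>a\<close> takes \<open>W\<close> to \<open>V\<close>,
  \<open>b\<close> takes \<open>V'\<close> to \<open>W'\<close>, and sending \<open>f\<close> to
  \<open>b \<circ> f \<circ> a\<close> is injective. Exchanging the two pairs gives
  equality.\<close>

lemma card_general_linear_maps_le: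
  assumes "V \<in> grassmannian k" "V' \<in> grassmannian k" "W \<in> grassmannian k" "W' \<in> grassmannian k"
  shows "card {f \<in> general_linear. f ` V = V'} \<le> card {f \<in> general_linear. f ` W = W'}"
proof -
  obtain a where a: "a \<in> general_linear" "a ` W = V"
    using general_linear_transitive assms by metis
  obtain b where b: "b \<in> general_linear" "b ` V' = W'"
    using general_linear_transitive assms by metis
  have "bij a" "bij b" using a b by (auto simp: general_linear_def)
  have "inj (\<lambda>f. b \<circ> f \<circ> a)"
  proof (rule injI)
    fix f g assume "b \<circ> f \<circ> a = b \<circ> g \<circ> a"
    then have "b (f (a x)) = b (g (a x))" for x by (metis comp_apply)
    then have "f (a x) = g (a x)" for x using \<open>bij b\<close> by (simp add: bij_def inj_eq)
    then show "f = g" using \<open>bij a\<close> by (metis bij_pointE ext)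
  qed
  moreover have "(\<lambda>f. b \<circ> f \<circ> a) ` {f \<in> general_linear. f ` V = V'} \<subseteq> {f \<in> general_linear. f ` W = W'}"
    using a b by (auto simp: general_linear_comp image_comp[symmetric])
  ultimately show ?thesis
    by (intro card_inj_on_le[of "\<lambda>f. b \<circ> f \<circ> a"]) (auto intro: inj_on_subset)
qed

text \<open>Orbit-stabiliser count: sorting the group by the image of \<open>V\<close> gives one
  class for each \<open>k\<close>-dimensional subspace, and all classes have the same size.\<close>

lemma card_general_linear_maps:
  assumes "V \<in> grassmannian k" "W \<in> grassmannian k"
  shows "card general_linear = card (grassmannian k) * card {f \<in> general_linear. f ` V = W}"
proof -
  have "general_linear = (\<Union>W'\<in>grassmannian k. {f \<in> general_linear. f ` V = W'})"
    using image_in_grassmannian[OF _ assms(1)] by auto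
  then have "card general_linear = card (\<Union>W'\<in>grassmannian k. {f \<in> general_linear. f ` V = W'})"
    by (rule arg_cong)
  also have "\<dots> = (\<Sum>W'\<in>grassmannian k. card {f \<in> general_linear. f ` V = W'})"
    by (rule card_UN_disjoint) auto
  also have "\<dots> = (\<Sum>W'\<in>grassmannian k. card {f \<in> general_linear. f ` V = W})"
    using assms by (intro sum.cong refl antisym card_general_linear_maps_le) auto
  finally show ?thesis by simp
qed

text \<open>Double counting of the pairs \<open>(f, W)\<close> with \<open>W\<close> in
  \<open>S\<close> and the image of \<open>W\<close> under \<open>f\<close> in \<open>U\<close>.
  Every \<open>f\<close> occurs in some pair, and the identity in \<open>card S > 1\<close> of them,
  which makes the inequality strict; every \<open>W\<close> occurs in \<open>card U * c\<close>
  pairs.\<close>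

lemma card_grassmannian_less:
  assumes S: "S \<subseteq> U" and U: "U \<subseteq> grassmannian k" and one: "1 < card S"
    and meet: "\<And>f. f \<in> general_linear \<Longrightarrow> image f ` S \<inter> U \<noteq> {}"
  shows "card (grassmannian k) < card S * card U"
proof -
  obtain V where V: "V \<in> S" using one by fastforce
  \<comment> \<open>The order of the stabiliser of \<open>V\<close>, which is also the number of
    group elements carrying any given member of \<open>U\<close> to any other.\<close>
  define c where "c = card {f \<in> general_linear. f ` V = V}"
  have gl: "card general_linear = card (grassmannian k) * c"
    unfolding c_def using card_general_linear_maps V S U by blast
  have c: "card {f \<in> general_linear. f ` W = W'} = c" if "W \<in> U" "W' \<in> U" for W W'
    unfolding c_def using V S U that by (intro antisym card_general_linear_maps_le[of _ k]) auto
  have pos: "0 < card {W \<in> S. f ` W \<in> U}" if "f \<in> general_linear" for f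
    using meet[OF that] by (auto simp: card_gt_0_iff)
  have id: "id \<in> general_linear"
    by (simp add: general_linear_def linear_id)
  have "card general_linear = (\<Sum>f\<in>general_linear. 1)" by simp
  also have "\<dots> < (\<Sum>f\<in>general_linear. card {W \<in> S. f ` W \<in> U})"
  proof (rule sum_strict_mono_ex1)
    have "{W \<in> S. id ` W \<in> U} = S" using S by auto
    then show "\<exists>f\<in>general_linear. 1 < card {W \<in> S. f ` W \<in> U}"
      using id one by (metis)
  qed (use pos in \<open>auto simp: Suc_le_eq\<close>)
  also have "\<dots> = (\<Sum>W\<in>S. card {f \<in> general_linear. f ` W \<in> U})"
    by (rule sum_multicount_gen) auto
  also have "\<dots> = (\<Sum>W\<in>S. card U * c)"
  proof (rule sum.cong[OF refl])
    fix W assume W: "W \<in> S"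
    have "{f \<in> general_linear. f ` W \<in> U} = (\<Union>W'\<in>U. {f \<in> general_linear. f ` W = W'})"
      by auto
    then have "card {f \<in> general_linear. f ` W \<in> U} = card (\<Union>W'\<in>U. {f \<in> general_linear. f ` W = W'})"
      by (rule arg_cong)
    also have "\<dots> = (\<Sum>W'\<in>U. card {f \<in> general_linear. f ` W = W'})"
      by (rule card_UN_disjoint) auto
    also have "\<dots> = card U * c"
      using W S c by (simp add: subset_iff)
    finally show "card {f \<in> general_linear. f ` W \<in> U} = card U * c" .
  qed
  finally have "card (grassmannian k) * c < (card S * card U) * c"
    by (simp add: gl mult.assoc)
  then show ?thesis by simp
qed

section \<open>Maximal partial parallelisms\<close>

lemma spread_subset_grassmannian: "spread scale k S \<Longrightarrow> S \<subseteq> grassmannian k"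
  by (auto simp: spread_def grassmannian_def)

text \<open>The members of a spread partition the nonzero vectors into blocks of size
  \<open>CARD('a) ^ k - 1\<close>.\<close>

lemma card_spread:
  assumes S: "spread scale k S"
  shows "card S * (CARD('a) ^ k - 1) = CARD('a) ^ dimension - 1"
proof -
  have sub: "subspace W" "dim W = k" if "W \<in> S" for W
    using S that by (auto simp: spread_def)
  have "UNIV - {0} = (\<Union>W\<in>S. W - {0})"
    using S by (auto simp: spread_def)
  then have "card (UNIV - {0 :: 'b}) = card (\<Union>W\<in>S. W - {0})"
    by (rule arg_cong)
  also have "\<dots> = (\<Sum>W\<in>S. card (W - {0}))"
    using S by (intro card_UN_disjoint) (auto simp: spread_def)
  also have "\<dots> = (\<Sum>W\<in>S. CARD('a) ^ k - 1)"
    using sub by (intro sum.cong refl) (simp add: subspace_0 card_subspace')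
  finally show ?thesis
    using card_subspace'[OF subspace_UNIV] by (simp add: dimension_def)
qed

lemma spread_image:
  assumes S: "spread scale k S" and f: "f \<in> general_linear"
  shows "spread scale k (image f ` S)"
  unfolding spread_def
proof (intro conjI ballI allI impI)
  fix W assume "W \<in> image f ` S"
  then have "W \<in> grassmannian k"
    using spread_subset_grassmannian[OF S] image_in_grassmannian[OF f] by auto
  then show "subspace W" "dim W = k" by (auto simp: grassmannian_def)
next
  fix v :: 'b assume v: "v \<noteq> 0"
  interpret f: Vector_Spaces.linear scale scale f
    using f by (simp add: general_linear_def)
  have bij: "bij f" using f by (simp add: general_linear_def)
  then obtain u where u: "v = f u" by (metis bij_pointE)
  then have "u \<noteq> 0" using v by auto
  then have "\<exists>!W. W \<in> S \<and> u \<in> W" using S by (simp add: spread_def)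
  moreover have "f u \<in> f ` W \<longleftrightarrow> u \<in> W" for W
    using bij by (simp add: bij_def inj_image_mem_iff)
  ultimately show "\<exists>!W. W \<in> image f ` S \<and> v \<in> W"
    unfolding u by blast
qed

text \<open>Some nonzero vector has to be covered. In the zero space the empty set is a
  spread.\<close>

lemma spread_nonempty:
  assumes "spread scale k S" "0 < dimension"
  shows "S \<noteq> {}"
proof -
  obtain v where "v \<in> Basis" using assms by (auto simp: dimension_def card_gt_0_iff)
  then have "v \<noteq> 0" using independent_Basis dependent_zero by auto
  then show ?thesis using assms by (auto simp: spread_def)
qed

text \<open>The second level covers collections of partial parallelisms, for the choice of a maximal
  one and for \<open>Max\<close>.\<close>

lemma finite_spread_sets [simp]: "finite (P :: 'b set set set)"
  and finite_spread_set_sets [simp]: "finite (\<P> :: 'b set set set set)"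
proof -
  show P: "finite P" for P :: "'b set set set"
    by (rule finite_subset[OF _ finite_Pow_iff[THEN iffD2, OF finite_vector_set_set[of UNIV]]]) simp
  show "finite \<P>"
    by (rule finite_subset[OF _ finite_Pow_iff[THEN iffD2, OF P[of UNIV]]]) simp
qed

text \<open>A spread avoiding \<open>\<Union>P\<close> could be added to \<open>P\<close>, so by
  maximality it already belongs to \<open>P\<close>; being nonempty, it would then meet
  \<open>\<Union>P\<close>.\<close>

lemma maximal_partial_parallelism:
  assumes S: "spread scale k S" and dim: "0 < dimension"
  obtains P where "partial_parallelism scale k P" "S \<in> P"
    "\<forall>T. spread scale k T \<longrightarrow> T \<inter> \<Union>P \<noteq> {}"
proof -
  have "{S} \<in> Collect (partial_parallelism scale k)"
    using S by (simp add: partial_parallelism_def pairwise_def)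
  then obtain P where P: "partial_parallelism scale k P" "{S} \<subseteq> P"
    and max: "\<And>Q. partial_parallelism scale k Q \<Longrightarrow> P \<subseteq> Q \<Longrightarrow> P = Q"
    using finite_has_maximal2[of "Collect (partial_parallelism scale k)" "{S}"] by auto
  have "T \<inter> \<Union>P \<noteq> {}" if T: "spread scale k T" for T
  proof
    assume disj: "T \<inter> \<Union>P = {}"
    then have "partial_parallelism scale k (insert T P)"
      using P T by (auto simp: partial_parallelism_def pairwise_insert disjnt_def)
    then have "T \<in> P" using max by blast
    then show False using disj spread_nonempty[OF T dim] by blast
  qed
  then show ?thesis using that P by blast
qed

text \<open>The averaging bound applies with \<open>U = \<Union>P\<close>, because images of
  \<open>S\<close> are spreads and so meet it. The members of \<open>P\<close> are disjoint and as
  large as \<open>S\<close>, which gives the size of \<open>U\<close>.\<close>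

lemma card_grassmannian_less_partial_parallelism:
  assumes S: "spread scale k S" and k: "0 < k" "k < dimension"
  shows "card (grassmannian k) < card S ^ 2 * max_partial_parallelism scale k"
proof -
  obtain P where P: "partial_parallelism scale k P" "S \<in> P"
    and meet: "\<forall>T. spread scale k T \<longrightarrow> T \<inter> \<Union>P \<noteq> {}"
    using maximal_partial_parallelism[OF S] k by (metis gr_zeroI not_less0)
  have sp: "spread scale k T" if "T \<in> P" for T
    using P that by (simp add: partial_parallelism_def)
  have q: "1 < CARD('a)" using two_le_card_field[OF finite_scalars] by simp
  have pos: "CARD('a) ^ k - 1 > 0" using one_less_power[OF q k(1)] by simp
  have same: "card T = card S" if "T \<in> P" for T
  proof -
    have "card T * (CARD('a) ^ k - 1) = card S * (CARD('a) ^ k - 1)"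
      by (simp only: card_spread[OF sp[OF that]] card_spread[OF S])
    then show ?thesis using pos by (simp only: mult_cancel2) simp
  qed
  have "card (\<Union>P) = sum card P"
    using P(1) by (intro card_Union_disjoint) (simp_all add: partial_parallelism_def)
  also have "\<dots> = (\<Sum>T\<in>P. card S)" using same by (rule sum.cong[OF refl])
  finally have U: "card (\<Union>P) = card P * card S" by simp
  have "CARD('a) ^ k < CARD('a) ^ dimension" using q k by simp
  \<comment> \<open>This is where \<open>k < dimension\<close> enters: a single
    \<open>k\<close>-dimensional subspace cannot cover all nonzero vectors.\<close>
  have one: "1 < card S"
  proof (rule ccontr)
    assume "\<not> 1 < card S"
    then have "card S * (CARD('a) ^ k - 1) \<le> 1 * (CARD('a) ^ k - 1)"
      by (intro mult_right_mono) auto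
    then have "CARD('a) ^ dimension - 1 \<le> CARD('a) ^ k - 1"
      unfolding card_spread[OF S] by simp
    then show False
      using \<open>CARD('a) ^ k < CARD('a) ^ dimension\<close> pos by linarith
  qed
  have "card (grassmannian k) < card S * card (\<Union>P)"
  proof (rule card_grassmannian_less)
    show "\<Union>P \<subseteq> grassmannian k" using sp spread_subset_grassmannian by blast
    show "S \<subseteq> \<Union>P" using P(2) by blast
    show "image f ` S \<inter> \<Union>P \<noteq> {}" if "f \<in> general_linear" for f
      using meet spread_image[OF S that] by simp
  qed (rule one)
  also have "\<dots> = card S ^ 2 * card P" by (simp add: U power2_eq_square)
  also have "\<dots> \<le> card S ^ 2 * max_partial_parallelism scale k"
    unfolding max_partial_parallelism_def using P by (intro mult_left_mono Max_ge) auto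
  finally show ?thesis .
qed

section \<open>From subspace counts to the Gaussian coefficient\<close>

lemma card_grassmannian_gaussian:
  assumes "0 < k" "k \<le> dimension"
  shows "real (card (grassmannian k)) * (real CARD('a) ^ k - 1) =
    (real CARD('a) ^ dimension - 1) * gaussian_coeff CARD('a) (dimension - 1) (k - 1)"
proof -
  define q where "q = CARD('a)"
  have q: "1 < real q" unfolding q_def using two_le_card_field[OF finite_scalars] by simp
  \<comment> \<open>Each factor loses \<open>q ^ i\<close>, and the factor at \<open>i = 0\<close>
    is split off. With \<open>m = dimension\<close> this yields the numerator of the Gaussian
    coefficient, with \<open>m = k\<close> its denominator; the powers of \<open>q\<close> then
    cancel.\<close>
  have prod: "real (\<Prod>i<k. q ^ m - q ^ i) =
      (\<Prod>i<k. real q ^ i) * ((real q ^ m - 1) * (\<Prod>i<k-1. real q ^ (m - 1 - i) - 1))"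
    if "k \<le> m" for m
  proof -
    obtain j where j: "k = Suc j" using assms by (cases k) auto
    have "real (\<Prod>i<k. q ^ m - q ^ i) = (\<Prod>i<k. real q ^ i * (real q ^ (m - i) - 1))"
      unfolding of_nat_prod
    proof (rule prod.cong[OF refl])
      fix i assume "i \<in> {..<k}"
      then have "i \<le> m" using that by simp
      moreover have "q ^ i \<le> q ^ m" using q \<open>i \<le> m\<close> by (intro power_increasing) auto
      ultimately show "real (q ^ m - q ^ i) = real q ^ i * (real q ^ (m - i) - 1)"
        by (simp add: of_nat_diff algebra_simps flip: power_add)
    qed
    also have "\<dots> = (\<Prod>i<k. real q ^ i) * (\<Prod>i<k. real q ^ (m - i) - 1)"
      by (rule prod.distrib)
    also have "(\<Prod>i<k. real q ^ (m - i) - 1) = (real q ^ m - 1) * (\<Prod>i<k-1. real q ^ (m - 1 - i) - 1)"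
      unfolding j by (subst prod.lessThan_Suc_shift) simp
    finally show ?thesis .
  qed
  have "real q ^ (k - 1 - i) - 1 \<noteq> 0" if "i < k - 1" for i
    using one_less_power[OF q, of "k - 1 - i"] that by linarith
  then have nz: "(\<Prod>i<k. real q ^ i) \<noteq> 0" "(\<Prod>i<k-1. real q ^ (k - 1 - i) - 1) \<noteq> 0"
    using q by (simp_all add: Ball_def)
  have "real (card (grassmannian k)) * real (\<Prod>i<k. q ^ k - q ^ i) = real (\<Prod>i<k. q ^ dimension - q ^ i)"
    using card_grassmannian[of k] unfolding q_def by (metis of_nat_mult)
  then have "real (card (grassmannian k)) * (real q ^ k - 1) * (\<Prod>i<k-1. real q ^ (k - 1 - i) - 1) =
     (real q ^ dimension - 1) * (\<Prod>i<k-1. real q ^ (dimension - 1 - i) - 1)"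
    unfolding prod[OF order.refl] prod[OF assms(2)]
    using nz(1) by (simp only: mult.left_commute[of "real (card (grassmannian k))"] mult_cancel_left
        mult.assoc simp_thms)
  then show ?thesis
    using nz(2) by (simp add: gaussian_coeff_def q_def field_simps)
qed

text \<open>In the abbreviations below, \<open>s * x = y\<close>, \<open>N = s * g\<close> and
  \<open>N < s * s * M\<close>. Hence \<open>g < s * M\<close>, while \<open>x / y\<close> is the
  reciprocal of \<open>s\<close>.\<close>

lemma max_partial_parallelism_gt:
  assumes S: "spread scale k S" and k: "0 < k" "k < dimension"
  shows "(real CARD('a) ^ k - 1) / (real CARD('a) ^ dimension - 1) *
      gaussian_coeff CARD('a) (dimension - 1) (k - 1) < real (max_partial_parallelism scale k)"
proof -
  define x y where "x = real CARD('a) ^ k - 1" and "y = real CARD('a) ^ dimension - 1"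
  define s N g M where "s = real (card S)" and "N = real (card (grassmannian k))"
    and "g = gaussian_coeff CARD('a) (dimension - 1) (k - 1)"
    and "M = real (max_partial_parallelism scale k)"
  have q: "1 < CARD('a)" using two_le_card_field[OF finite_scalars] by simp
  have pos: "0 < x" "0 < y" using q k by (auto simp: x_def y_def)
  have "real (card S * (CARD('a) ^ k - 1)) = real (CARD('a) ^ dimension - 1)"
    using card_spread[OF S] by simp
  then have y: "s * x = y"
    using q by (simp add: s_def x_def y_def of_nat_diff)
  then have s: "0 < s" using pos zero_less_mult_pos2 by metis
  have "N * x = y * g"
    unfolding N_def x_def y_def g_def using k by (intro card_grassmannian_gaussian) auto
  then have N: "N = s * g" using pos y by auto
  have "real (card (grassmannian k)) < real (card S ^ 2 * max_partial_parallelism scale k)"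
    using card_grassmannian_less_partial_parallelism[OF assms] by (simp only: of_nat_less_iff)
  then have "s * g < s * (s * M)"
    using N by (simp add: N_def s_def M_def power2_eq_square mult_ac)
  then have "g < s * M" using s by simp
  moreover have "x / y * g = g / s" using y pos s by (auto simp: field_simps)
  ultimately show ?thesis
    using s unfolding x_def[symmetric] y_def[symmetric] g_def[symmetric] M_def[symmetric]
    by (simp add: divide_less_eq mult_ac)
qed

end


section \<open>Spreads from field extensions\<close>

lemma field_power_card:
  fixes x :: "'a::{field,finite}"
  shows "x ^ CARD('a) = x"
proof (cases "x = 0")
  case False
  let ?U = "UNIV - {0 :: 'a}"
  \<comment> \<open>Multiplication by \<open>x\<close> permutes the nonzero scalars, so their
    product is unchanged when every factor is multiplied by \<open>x\<close>.\<close>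
  have "bij_betw ((*) x) ?U ?U"
    using False by (intro bij_betwI[where g = "\<lambda>y. y / x"]) auto
  then have "(\<Prod>y\<in>?U. y) = (\<Prod>y\<in>?U. x * y)"
    by (rule prod.reindex_bij_betw[symmetric])
  also have "\<dots> = x ^ card ?U * (\<Prod>y\<in>?U. y)"
    by (simp add: prod.distrib)
  finally have "x ^ card ?U = 1"
    by simp
  moreover have "CARD('a) = Suc (card ?U)"
    by (simp add: card_Suc_Diff1)
  ultimately show ?thesis by (simp only: power_Suc mult_1_right)
qed simp

text \<open>\<open>(1 + y) ^ q - 1 - y ^ q\<close> vanishes at all \<open>q\<close> scalars \<open>y\<close> but has degree less than \<open>q\<close>.\<close>
lemma of_nat_card_choose_eq_0:
  assumes "0 < i" "i < CARD('a::{field,finite})"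
  shows "of_nat (CARD('a) choose i) = (0 :: 'a)"
proof -
  define q where "q = CARD('a)"
  define p :: "'a poly" where "p = (\<Sum>i=1..<q. monom (of_nat (q choose i)) i)"
  have coeff: "coeff p i = (if i \<in> {1..<q} then of_nat (q choose i) else 0)" for i
    by (simp add: p_def coeff_sum)
  have "poly p y = 0" for y
  proof -
    have "0 < q" by (simp add: q_def)
    then have split: "{..q} = insert 0 (insert q {1..<q})" by auto
    have "(y + 1) ^ q = (\<Sum>i\<le>q. of_nat (q choose i) * y ^ i)"
      by (subst binomial_ring) simp
    also have "\<dots> = 1 + y ^ q + poly p y"
      unfolding split using \<open>0 < q\<close> by (simp add: p_def poly_sum poly_monom)
    \<comment> \<open>As \<open>q\<close>-th powers fix all scalars, the equation reads
      \<open>y + 1 = 1 + y + poly p y\<close>.\<close>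
    finally show ?thesis by (simp add: q_def field_power_card)
  qed
  then have "card {x. poly p x = 0} = q" by (simp add: q_def)
  moreover have "degree p \<le> q - 1" by (rule degree_le) (auto simp: coeff)
  moreover have "0 < q" by (simp add: q_def)
  ultimately have "p = 0"
    using card_poly_roots_bound[of p] by (cases "p = 0") auto
  then show ?thesis
    using coeff[of i] assms by (simp add: q_def)
qed

text \<open>The inner binomial coefficients vanish in the scalars, hence also in the closure; the
  case \<open>j = 1\<close> is then iterated.\<close>

lemma alg_closure_add_power_card:
  fixes x y :: "'a::{field,finite} alg_closure"
  shows "(x + y) ^ (CARD('a) ^ j) = x ^ (CARD('a) ^ j) + y ^ (CARD('a) ^ j)"
proof -
  define q where "q = CARD('a)"
  have q: "0 < q" by (simp add: q_def)
  have zero: "of_nat (q choose i) = (0 :: 'a alg_closure)" if "i \<in> {1..<q}" for i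
    using arg_cong[OF of_nat_card_choose_eq_0[where ?'a = 'a and i = i], of to_ac] that
    by (simp add: q_def)
  have add: "(x + y) ^ q = x ^ q + y ^ q" for x y :: "'a alg_closure"
  proof -
    have split: "{..q} = insert 0 (insert q {1..<q})" using q by auto
    have "(x + y) ^ q = (\<Sum>i\<le>q. of_nat (q choose i) * x ^ i * y ^ (q - i))"
      by (rule binomial_ring)
    also have "\<dots> = x ^ q + y ^ q"
      unfolding split using q by (simp add: zero)
    finally show ?thesis .
  qed
  show ?thesis
    unfolding q_def[symmetric] by (induction j) (simp_all add: add power_mult mult.commute[of q])
qed

text \<open>The field with \<open>q ^ j\<close> elements for \<open>j > 0\<close>, but the whole closure for \<open>j = 0\<close>.\<close>
definition subfield_of_degree :: "nat \<Rightarrow> 'a::{field,finite} alg_closure set" where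
  "subfield_of_degree j = {x. x ^ (CARD('a) ^ j) = x}"

text \<open>These are the fixed points of a map that respects addition, multiplication and
  division.\<close>

lemma subfield_of_degree_closed:
  fixes x y :: "'a::{field,finite} alg_closure"
  shows subfield_0: "(0 :: 'a alg_closure) \<in> subfield_of_degree j"
    and subfield_1: "(1 :: 'a alg_closure) \<in> subfield_of_degree j"
    and subfield_add: "x \<in> subfield_of_degree j \<Longrightarrow> y \<in> subfield_of_degree j \<Longrightarrow>
          x + y \<in> subfield_of_degree j"
    and subfield_mult: "x \<in> subfield_of_degree j \<Longrightarrow> y \<in> subfield_of_degree j \<Longrightarrow>
          x * y \<in> subfield_of_degree j"
    and subfield_divide: "x \<in> subfield_of_degree j \<Longrightarrow> y \<in> subfield_of_degree j \<Longrightarrow>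
          x / y \<in> subfield_of_degree j"
  by (simp_all add: subfield_of_degree_def alg_closure_add_power_card power_mult_distrib power_divide)

lemma to_ac_in_subfield: "to_ac c \<in> subfield_of_degree j"
proof (induction j)
  case (Suc j)
  then show ?case
    by (simp add: subfield_of_degree_def power_mult flip: to_ac_power add: field_power_card)
qed (simp add: subfield_of_degree_def)

text \<open>Raising to the power \<open>CARD('a) ^ (k * m)\<close> is the \<open>m\<close>-fold
  iterate of raising to the power \<open>CARD('a) ^ k\<close>, so it keeps the fixed points of the
  latter.\<close>

lemma subfield_of_degree_mono:
  assumes "k dvd n"
  shows "subfield_of_degree k \<subseteq> subfield_of_degree n"
proof
  fix x :: "'a alg_closure" assume x: "x \<in> subfield_of_degree k"
  obtain m where "n = k * m" using assms by blast
  moreover have "x \<in> subfield_of_degree (k * m)"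
  proof (induction m)
    case (Suc m)
    then show ?case
      using x by (simp add: subfield_of_degree_def power_add power_mult)
  qed (simp add: subfield_of_degree_def)
  ultimately show "x \<in> subfield_of_degree n" by simp
qed

section \<open>Counting roots and the orders of the subfields\<close>

text \<open>The polynomial splits, so its roots with multiplicity number \<open>degree p\<close>; a
  multiple root would also be a root of the derivative.\<close>

lemma card_roots_eq_degree:
  fixes p :: "'a::alg_closed_field poly"
  assumes simple: "\<And>x. poly p x = 0 \<Longrightarrow> poly (pderiv p) x \<noteq> 0"
  shows "card {x. poly p x = 0} = degree p"
proof -
  have p: "p \<noteq> 0" using simple by auto
  obtain A where A: "size A = degree p" "p = smult (lead_coeff p) (\<Prod>x\<in>#A. [:-x, 1:])"
    using alg_closed_imp_factorization[OF p] by blast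
  have "proots p = proots (\<Prod>x\<in>#A. [:-x, 1:])"
    using A(2) p by (metis leading_coeff_0_iff proots_smult)
  also have "\<dots> = A"
  proof (induction A)
    case (add x A)
    have "(\<Prod>x\<in>#A. [:-x, 1:]) \<noteq> 0" by auto
    then show ?case using add by (simp add: proots_mult del: mult_pCons_left)
  qed simp
  finally have "size (proots p) = degree p" using A by simp
  moreover have "size (proots p) = card (set_mset (proots p))"
  proof -
    have "count (proots p) x = 1" if "x \<in># proots p" for x
    proof -
      have root: "poly p x = 0" using that p by simp
      have "\<not> 2 \<le> order x p"
      proof
        assume "2 \<le> order x p"
        then have "[:-x, 1:] ^ 2 dvd p"
          by (metis le_imp_power_dvd dvd_trans order_1)
        then obtain r where "p = [:-x, 1:] * ([:-x, 1:] * r)"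
          unfolding dvd_def power2_eq_square mult.assoc by blast
        then have "poly (pderiv p) x = 0"
          by (simp only: pderiv_mult poly_add poly_mult) simp
        then show False using simple root by blast
      qed
      moreover have "order x p \<noteq> 0" using root p by (simp add: order_root)
      ultimately show ?thesis using p by simp
    qed
    then show ?thesis by (simp add: size_multiset_overloaded_eq)
  qed
  ultimately show ?thesis using p by simp
qed

text \<open>The elements are the roots of \<open>x ^ Q - x\<close>, whose derivative is -1 because
  \<open>Q\<close> vanishes in the field.\<close>

lemma card_subfield_of_degree:
  assumes "0 < j"
  shows "card (subfield_of_degree j :: 'a::{field,finite} alg_closure set) = CARD('a) ^ j"
proof -
  define Q where "Q = CARD('a) ^ j"
  define p :: "'a alg_closure poly" where "p = monom 1 Q - [:0, 1:]"
  have q: "1 < CARD('a)" using two_le_card_field[where ?'a = 'a] by simp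
  have Q: "1 < Q" unfolding Q_def using one_less_power[OF q assms] .
  \<comment> \<open>The binomial coefficient with \<open>i = 1\<close> is \<open>CARD('a)\<close>
    itself.\<close>
  have "of_nat (CARD('a)) = (0 :: 'a alg_closure)"
    using arg_cong[OF of_nat_card_choose_eq_0[where ?'a = 'a and i = 1], of to_ac] q by simp
  then have "of_nat Q = (0 :: 'a alg_closure)" using assms by (simp add: Q_def)
  then have "pderiv p = -1"
    by (simp add: p_def pderiv_diff pderiv_monom pderiv_pCons one_pCons)
  then have "card {x. poly p x = 0} = degree p" by (intro card_roots_eq_degree) simp
  moreover have "degree p = Q"
    unfolding p_def using Q by (subst diff_conv_add_uminus, subst degree_add_eq_left) (auto simp: degree_monom_eq)
  moreover have "{x. poly p x = 0} = subfield_of_degree j"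
    by (auto simp: p_def subfield_of_degree_def Q_def poly_monom)
  ultimately show ?thesis
    by (simp add: Q_def)
qed

section \<open>Transport of the multiplicative cosets to the given space\<close>

abbreviation scale_ac :: "'a::field \<Rightarrow> 'a alg_closure \<Rightarrow> 'a alg_closure" where
  "scale_ac c x \<equiv> to_ac c * x"

lemma vector_space_alg_closure: "vector_space scale_ac"
  by unfold_locales (simp_all add: algebra_simps)

lemma ex_spread:
  fixes scale :: "'a::{field,finite} \<Rightarrow> 'b::ab_group_add \<Rightarrow> 'b"
  assumes "finite_vector_space scale Basis" and "0 < k" and "k dvd vector_space.dim scale UNIV"
    and dim: "0 < vector_space.dim scale UNIV"
  shows "\<exists>S. spread scale k S"
proof -
  interpret V: finite_vector_space scale Basis by fact
  interpret L: vector_space "scale_ac :: 'a \<Rightarrow> _" by (rule vector_space_alg_closure)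
  interpret LV: vector_space_pair "scale_ac :: 'a \<Rightarrow> _" scale ..
  define n where "n = V.dim UNIV"
  define K W :: "'a alg_closure set" where "K = subfield_of_degree k" and "W = subfield_of_degree n"
  have q: "1 < CARD('a)" using two_le_card_field[where ?'a = 'a] by simp
  have cards: "card K = CARD('a) ^ k" "card W = CARD('a) ^ n"
    using assms by (simp_all add: K_def W_def n_def card_subfield_of_degree)
  have "finite W" using cards(2) by (simp add: card_ge_0_finite)
  \<comment> \<open>Here the divisibility of \<open>n\<close> by \<open>k\<close> enters.\<close>
  have "K \<subseteq> W" using assms by (simp add: K_def W_def n_def subfield_of_degree_mono)
  \<comment> \<open>Used with \<open>w = 1\<close> and \<open>j = n\<close> for \<open>W\<close>
    itself, and with \<open>j = k\<close> for the members of the spread.\<close>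
  have line_subspace: "L.subspace ((\<lambda>x. x * w) ` subfield_of_degree j)" for w j
  proof (rule L.subspaceI)
    show "0 \<in> (\<lambda>x. x * w) ` subfield_of_degree j"
      by (rule image_eqI[of _ _ 0]) (simp_all add: subfield_0)
  next
    fix x y assume "x \<in> (\<lambda>x. x * w) ` subfield_of_degree j" "y \<in> (\<lambda>x. x * w) ` subfield_of_degree j"
    then show "x + y \<in> (\<lambda>x. x * w) ` subfield_of_degree j"
      using subfield_add by (fastforce simp flip: distrib_right)
  next
    fix c x assume "x \<in> (\<lambda>x. x * w) ` subfield_of_degree j"
    then show "scale_ac c x \<in> (\<lambda>x. x * w) ` subfield_of_degree j"
      using subfield_mult[OF to_ac_in_subfield] by (fastforce simp flip: mult.assoc)
  qed
  have W: "L.subspace W" using line_subspace[of 1 n] by (simp add: W_def)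
  then have "L.dim W = n"
    using L.card_subspace[of W] \<open>finite W\<close> cards q by simp
  moreover obtain B where B: "B \<subseteq> W" "L.independent B" "W \<subseteq> L.span B" "card B = L.dim W"
    using L.basis_exists by metis
  moreover obtain C where C: "C \<subseteq> UNIV" "V.independent C" "UNIV \<subseteq> V.span C" "card C = V.dim UNIV"
    using V.basis_exists by metis
  \<comment> \<open>\<open>W\<close> has \<open>CARD('a) ^ n\<close> elements, hence dimension
    \<open>n\<close>, and is isomorphic to the given space. The map \<open>f\<close> is defined on
    the whole closure but is injective only on \<open>W\<close>, so the lines must be kept inside
    \<open>W\<close>.\<close>
  ultimately obtain f where f: "Vector_Spaces.linear scale_ac scale f" "f ` W = UNIV" "inj_on f W"
    using LV.finite_basis_to_basis_subspace_isomorphism[OF W V.subspace_UNIV _ _ B _ C]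
      finite_subset[OF B(1) \<open>finite W\<close>] by (auto simp: n_def)
  interpret f: Vector_Spaces.linear "scale_ac :: 'a \<Rightarrow> _" scale f by (rule f(1))
  define line where "line w = (\<lambda>x. x * w) ` K" for w
  have line_W: "line w \<subseteq> W" if "w \<in> W" for w
    using that \<open>K \<subseteq> W\<close> by (auto simp: line_def W_def subfield_mult)
  have "spread scale k ((\<lambda>w. f ` line w) ` (W - {0}))"
    unfolding spread_def
  proof (intro conjI ballI allI impI)
    fix U assume "U \<in> (\<lambda>w. f ` line w) ` (W - {0})"
    then obtain w where w: "w \<in> W" "w \<noteq> 0" "U = f ` line w" by blast
    show U: "V.subspace U"
      unfolding w line_def K_def by (rule f.subspace_image[OF line_subspace])
    have "card U = card (line w)"
      unfolding w using f(3) line_W[OF w(1)] by (intro card_image) (rule inj_on_subset)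
    also have "\<dots> = card K"
      unfolding line_def using w(2) by (intro card_image) (auto simp: inj_on_def)
    finally show "V.dim U = k"
      using cards V.card_subspace'[OF U] q by simp
  next
    fix v :: 'b assume "v \<noteq> 0"
    obtain u where u: "u \<in> W" "v = f u" using f(2) by blast
    then have "u \<noteq> 0" using \<open>v \<noteq> 0\<close> by auto
    show "\<exists>!U. U \<in> (\<lambda>w. f ` line w) ` (W - {0}) \<and> v \<in> U"
    proof (rule ex1I[of _ "f ` line u"])
      have "u \<in> line u" by (auto simp: line_def K_def subfield_1 intro!: image_eqI[of _ _ 1])
      then show "f ` line u \<in> (\<lambda>w. f ` line w) ` (W - {0}) \<and> v \<in> f ` line u"
        using u \<open>u \<noteq> 0\<close> by auto
    next
      fix U assume "U \<in> (\<lambda>w. f ` line w) ` (W - {0}) \<and> v \<in> U"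
      then obtain w x where w: "w \<in> W" "U = f ` line w" "x \<in> K" "v = f (x * w)"
        by (auto simp: line_def)
      have "x * w \<in> W" using w line_W[of w] by (auto simp: line_def)
      then have xw: "u = x * w" using u w f(3) by (auto dest: inj_onD)
      then have "x \<noteq> 0" using \<open>u \<noteq> 0\<close> by auto
      \<comment> \<open>The quotient \<open>x\<close> of \<open>u\<close> by \<open>w\<close> is a
        nonzero element of \<open>K\<close>, so both generate the same coset.\<close>
      have "line w = line u"
      proof (intro equalityI subsetI)
        fix z assume "z \<in> line w"
        then obtain y where "y \<in> K" "z = (y / x) * u" using \<open>x \<noteq> 0\<close> by (auto simp: line_def xw)
        then show "z \<in> line u" using \<open>x \<in> K\<close>
          unfolding line_def K_def by (intro image_eqI[of _ _ "y / x"]) (simp_all add: subfield_divide)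
      next
        fix z assume "z \<in> line u"
        then obtain y where "y \<in> K" "z = (y * x) * w" by (auto simp: line_def xw)
        then show "z \<in> line w" using \<open>x \<in> K\<close>
          unfolding line_def K_def by (intro image_eqI[of _ _ "y * x"]) (simp_all add: subfield_mult)
      qed
      then show "U = f ` line u" using w by simp
    qed
  qed
  then show ?thesis by blast
qed

theorem corollary3p4:
  fixes scale :: "'a::{field,finite} \<Rightarrow> 'b::ab_group_add \<Rightarrow> 'b"
    and q n k :: nat
  assumes "vector_space scale"
    and "CARD('a) = q"
    and "vector_space.dim scale UNIV = n"
    and "0 < k" and "k < n" and "k dvd n"
  shows "real (max_partial_parallelism scale k)
           > (real q ^ k - 1) / (real q ^ n - 1) * gaussian_coeff q (n - 1) (k - 1)"
proof -
  interpret vector_space scale by fact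
  obtain B where B: "independent B" "UNIV \<subseteq> span B" "card B = n"
    using basis_exists[of UNIV] assms(3) by metis
  \<comment> \<open>Infinite sets have \<open>card\<close> 0, so \<open>n > 0\<close> makes the
    basis finite.\<close>
  interpret finite_vector_space scale B
    using B assms(4,5) by unfold_locales (auto intro: card_ge_0_finite)
  have n: "dimension = n" using B by (simp add: dimension_def)
  obtain S where "spread scale k S"
    using ex_spread[OF finite_vector_space_axioms, of k] assms by auto
  then show ?thesis
    using max_partial_parallelism_gt[of k S] assms n by simp
qed

end
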